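(* Let $S\subseteq V^{\setminus i}$, $\alpha=\alpha_{\mathrm{ess}}/q(S)$ and $j_S\in\mathcal{D}_u^{S}$. For $j\in\mathcal{D}_u^{V^{\setminus i}}$ let $\overline{h}_{\vec{n}_j}(\alpha)=h_{\vec{n}_j}(\alpha)$ if $\alpha\le 1$ and $\frac{\partial h_{\vec{n}_j}}{\partial\alpha}(\alpha)\ge 0$, and $\overline{h}_{\vec{n}_j}(\alpha)=0$ otherwise. Let $$\underline{h}(S,j_S)=\sum_{\substack{j\in\mathcal{D}_u^{V^{\setminus i}}:\\ j^{S}=j_S}}\mathrm{ML}(\vec{n}_j)+\min_{\substack{j\in\mathcal{D}_u^{V^{\setminus i}}:\\ j^{S}=j_S}}\Big(-\mathrm{ML}(\vec{n}_j)+\min\big\{\mathrm{ML}(\vec{n}_j);\ f(V^{\setminus i},j)+g(V^{\setminus i},j,\alpha);\ \overline{h}_{\vec{n}_j}(\alpha)\big\}\Big).$$ Then $\mathrm{LLBDeu}(S,j_S)\le\underline{h}(S,j_S)$. Moreover, if $\mathrm{LBDeu}(S')\ge\underline{h}(S):=\sum_{j_S\in\mathcal{D}_u^{S}}\underline{h}(S,j_S)$ for some proper subset $S'\subset S$, then $S$ and all its supersets $T\subseteq V^{\setminus i}$ are not in $\mathcal{L}_i$.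
   Context: Let $V=\{1,\dots,n\}$ index discrete random variables, fix a child variable $i\in V$ and put $V^{\setminus i}=V\setminus\{i\}$. Each variable $v$ has a finite nonempty state space $c(v)$; for $S\subseteq V$, $c(S)=\prod_{v\in S}c(v)$ (a singleton if $S=\emptyset$) and $q(S)=|c(S)|$; $q(i)=|c(i)|$. For $j\in c(S')$ and $S\subseteq S'$, $j^{S}\in c(S)$ is the projection of $j$. The data $\mathcal{D}$ is a finite multiset of elements of $c(V)$; $\mathcal{D}^{S}$ is the multiset of projections onto $S$, and $\mathcal{D}_u^{S}$ is the set of distinct elements of $\mathcal{D}^{S}$. For $S\subseteq V^{\setminus i}$ and $j\in c(S)$, $\mathcal{D}_u^{S\cup\{i\}}(j)$ is the set of elements of $\mathcal{D}_u^{S\cup\{i\}}$ whose projection onto $S$ is $j$; $n_j$ is the number of occurrences of $j$ in $\mathcal{D}^{S}$, and for $k\in c(i)$, $n_{j,k}$ is the number of elements of $\mathcal{D}^{S\cup\{i\}}$ (with multiplicity) with $S$-part $j$ and $i$-part $k$, so $n_j=\sum_k n_{j,k}$; $\vec{n}_j=(n_{j,k})_{k\in c(i)}$. Fix $\alpha_{\mathrm{ess}}>0$. For $j\in c(S)$, $\alpha_j=\alpha_{\mathrm{ess}}/q(S)$ and $\alpha_{j,k}=\alpha_{\mathrm{ess}}/(q(S)q(i))$. With $\Gamma_\alpha(x)=\Gamma(x+\alpha)/\Gamma(\alpha)$, $$\mathrm{LLBDeu}(S,j)=-\log\Gamma_{\alpha_j}(n_j)+\sum_{k\in c(i)}\log\Gamma_{\alpha_{j,k}}(n_{j,k}),\qquad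 \mathrm{LBDeu}(S)=\sum_{j\in\mathcal{D}_u^{S}}\mathrm{LLBDeu}(S,j).$$ $\mathcal{L}_i=\{S\subseteq V^{\setminus i}:\ \mathrm{LBDeu}(S')<\mathrm{LBDeu}(S)\text{ for every proper subset }S'\subset S\}$. For $S\subseteq V^{\setminus i}$ and $j\in\mathcal{D}_u^{S}$: $f(S,j)=-|\mathcal{D}_u^{S\cup\{i\}}(j)|\log q(i)$. For $\alpha>0$, $g(S,j,\alpha)=-\sum_{l=1}^{k'-1}\log(1+n_{j,l}/\alpha)$, where the counts $(n_{j,k})_{k\in c(i)}$ are listed in non-increasing order as $n_{j,1}\ge\dots\ge n_{j,q(i)}$ and $k'$ is the largest index with $n_{j,k'}>0$. Further, $\mathrm{ML}(\vec{n}_j)=\sum_{k\in c(i)}n_{j,k}\log(n_{j,k}/n_j)$ with $0\log 0=0$, and for $\alpha>0$, $h_{\vec{n}_j}(\alpha)=-\log\Gamma_{\alpha}(n_j)+\sum_{k\in c(i)}\log\Gamma_{\alpha/q(i)}(n_{j,k})$, a function of $\alpha$ for fixed $\vec{n}_j$. *)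

theory Defs
  imports "HOL-Analysis.Analysis" "HOL-Library.Multiset" "HOL-Library.FuncSet"
begin

text \<open>Variables are natural numbers and \<open>c v\<close> is the state space of variable \<open>v\<close>. A joint
  configuration of \<open>S\<close> is an element of \<open>PiE S c\<close> (a function that is \<open>undefined\<close> off \<open>S\<close>), so
  the projection of \<open>j\<close> onto \<open>S\<close> is \<open>restrict j S\<close>, and \<open>PiE {} c\<close> is a singleton.\<close>

definition q :: "(nat \<Rightarrow> 'a set) \<Rightarrow> nat set \<Rightarrow> nat" where
  "q c S = card (PiE S c)"

definition data_proj :: "(nat \<Rightarrow> 'a) multiset \<Rightarrow> nat set \<Rightarrow> (nat \<Rightarrow> 'a) multiset" where
  "data_proj D S = image_mset (\<lambda>x. restrict x S) D"

definition data_u :: "(nat \<Rightarrow> 'a) multiset \<Rightarrow> nat set \<Rightarrow> (nat \<Rightarrow> 'a) set" where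
  "data_u D S = set_mset (data_proj D S)"

text \<open>The distinct elements of the data on \<open>S \<union> {i}\<close> whose projection onto \<open>S\<close> is \<open>j\<close>.\<close>

definition data_u_at ::
    "(nat \<Rightarrow> 'a) multiset \<Rightarrow> nat \<Rightarrow> nat set \<Rightarrow> (nat \<Rightarrow> 'a) \<Rightarrow> (nat \<Rightarrow> 'a) set" where
  "data_u_at D i S j = {x \<in> data_u D (S \<union> {i}). restrict x S = j}"

text \<open>\<open>n_tot D S j\<close> is $n_j$, and \<open>n_vec D i S j\<close> is the vector $(n_{j,k})_k$.\<close>

definition n_tot :: "(nat \<Rightarrow> 'a) multiset \<Rightarrow> nat set \<Rightarrow> (nat \<Rightarrow> 'a) \<Rightarrow> nat" where
  "n_tot D S j = count (data_proj D S) j"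

definition n_vec ::
    "(nat \<Rightarrow> 'a) multiset \<Rightarrow> nat \<Rightarrow> nat set \<Rightarrow> (nat \<Rightarrow> 'a) \<Rightarrow> 'a \<Rightarrow> nat" where
  "n_vec D i S j k = size {#x \<in># data_proj D (S \<union> {i}). restrict x S = j \<and> x i = k#}"

definition Gamma_ratio :: "real \<Rightarrow> real \<Rightarrow> real" where
  "Gamma_ratio \<alpha> x = Gamma (x + \<alpha>) / Gamma \<alpha>"

definition LLBDeu ::
    "real \<Rightarrow> (nat \<Rightarrow> 'a set) \<Rightarrow> (nat \<Rightarrow> 'a) multiset \<Rightarrow> nat \<Rightarrow> nat set \<Rightarrow> (nat \<Rightarrow> 'a) \<Rightarrow> real" where
  "LLBDeu \<alpha>ess c D i S j =
     - ln (Gamma_ratio (\<alpha>ess / real (q c S)) (real (n_tot D S j)))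
     + (\<Sum>k\<in>c i. ln (Gamma_ratio (\<alpha>ess / (real (q c S) * real (card (c i))))
                                 (real (n_vec D i S j k))))"

definition LBDeu ::
    "real \<Rightarrow> (nat \<Rightarrow> 'a set) \<Rightarrow> (nat \<Rightarrow> 'a) multiset \<Rightarrow> nat \<Rightarrow> nat set \<Rightarrow> real" where
  "LBDeu \<alpha>ess c D i S = (\<Sum>j\<in>data_u D S. LLBDeu \<alpha>ess c D i S j)"

definition candidate_sets ::
    "real \<Rightarrow> (nat \<Rightarrow> 'a set) \<Rightarrow> (nat \<Rightarrow> 'a) multiset \<Rightarrow> nat set \<Rightarrow> nat \<Rightarrow> nat set set" where
  "candidate_sets \<alpha>ess c D V i =
     {S. S \<subseteq> V - {i} \<and> (\<forall>S'. S' \<subset> S \<longrightarrow> LBDeu \<alpha>ess c D i S' < LBDeu \<alpha>ess c D i S)}"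

definition f_bound ::
    "(nat \<Rightarrow> 'a set) \<Rightarrow> (nat \<Rightarrow> 'a) multiset \<Rightarrow> nat \<Rightarrow> nat set \<Rightarrow> (nat \<Rightarrow> 'a) \<Rightarrow> real" where
  "f_bound c D i S j = - real (card (data_u_at D i S j)) * ln (real (card (c i)))"

text \<open>The entries of a count vector over \<open>K\<close>, listed in non-increasing order.\<close>

definition counts_desc :: "'a set \<Rightarrow> ('a \<Rightarrow> nat) \<Rightarrow> nat list" where
  "counts_desc K m = rev (sorted_list_of_multiset (image_mset m (mset_set K)))"

text \<open>In \<open>last_pos\<close> and \<open>g_bound\<close> the positions are counted from 1, hence the shift in \<open>!\<close>.
  \<open>last_pos ns\<close> is only meaningful when some entry of \<open>ns\<close> is positive, which is the case for
  the counts of every \<open>j \<in> data_u D S\<close>.\<close>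

definition last_pos :: "nat list \<Rightarrow> nat" where
  "last_pos ns = (GREATEST l. l \<in> {1..length ns} \<and> ns ! (l - 1) > 0)"

definition g_bound ::
    "(nat \<Rightarrow> 'a set) \<Rightarrow> (nat \<Rightarrow> 'a) multiset \<Rightarrow> nat \<Rightarrow> nat set \<Rightarrow> (nat \<Rightarrow> 'a) \<Rightarrow> real \<Rightarrow> real" where
  "g_bound c D i S j \<alpha> =
     (let ns = counts_desc (c i) (n_vec D i S j)
      in - (\<Sum>l\<in>{1..last_pos ns - 1}. ln (1 + real (ns ! (l - 1)) / \<alpha>)))"

text \<open>For a count vector \<open>m\<close> over the set \<open>K\<close> of child states. The total \<open>sum m K\<close> is $n_j$ when
  \<open>m\<close> is the vector of $j$, see \<open>sum_n_vec\<close> below. The convention $0 \log 0 = 0$ holds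
  automatically.\<close>

definition max_loglik :: "'a set \<Rightarrow> ('a \<Rightarrow> nat) \<Rightarrow> real" where
  "max_loglik K m = (\<Sum>k\<in>K. real (m k) * ln (real (m k) / real (sum m K)))"

definition h_fun :: "'a set \<Rightarrow> ('a \<Rightarrow> nat) \<Rightarrow> real \<Rightarrow> real" where
  "h_fun K m \<alpha> =
     - ln (Gamma_ratio \<alpha> (real (sum m K)))
     + (\<Sum>k\<in>K. ln (Gamma_ratio (\<alpha> / real (card K)) (real (m k))))"

definition h_bar :: "'a set \<Rightarrow> ('a \<Rightarrow> nat) \<Rightarrow> real \<Rightarrow> real" where
  "h_bar K m \<alpha> = (if \<alpha> \<le> 1 \<and> deriv (h_fun K m) \<alpha> \<ge> 0 then h_fun K m \<alpha> else 0)"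

definition h_under ::
    "real \<Rightarrow> (nat \<Rightarrow> 'a set) \<Rightarrow> (nat \<Rightarrow> 'a) multiset \<Rightarrow> nat set \<Rightarrow> nat \<Rightarrow> nat set \<Rightarrow> (nat \<Rightarrow> 'a) \<Rightarrow> real"
  where
  "h_under \<alpha>ess c D V i S jS =
     (let W = V - {i};
          \<alpha> = \<alpha>ess / real (q c S);
          J = {j \<in> data_u D W. restrict j S = jS};
          ml = (\<lambda>j. max_loglik (c i) (n_vec D i W j))
      in (\<Sum>j\<in>J. ml j)
         + (MIN j\<in>J. - ml j
              + Min {ml j,
                     f_bound c D i W j + g_bound c D i W j \<alpha>,
                     h_bar (c i) (n_vec D i W j) \<alpha>}))"

definition h_under_total ::
    "real \<Rightarrow> (nat \<Rightarrow> 'a set) \<Rightarrow> (nat \<Rightarrow> 'a) multiset \<Rightarrow> nat set \<Rightarrow> nat \<Rightarrow> nat set \<Rightarrow> real" where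
  "h_under_total \<alpha>ess c D V i S = (\<Sum>jS\<in>data_u D S. h_under \<alpha>ess c D V i S jS)"

lemma sum_n_vec:
  assumes "finite (c i)" and "\<And>x. x \<in># D \<Longrightarrow> x i \<in> c i"
  shows "(\<Sum>k\<in>c i. n_vec D i S j k) = n_tot D S j"
  using assms(2)
proof (induction D)
  case empty
  then show ?case by (simp add: n_vec_def n_tot_def data_proj_def)
next
  case (add x D)
  have S: "S \<inter> insert i S = S" "insert i S \<inter> S = S" by auto
  have step: "n_vec (add_mset x D) i S j k
      = n_vec D i S j k + (if k = x i then if restrict x S = j then 1 else 0 else 0)" for k
    by (auto simp: n_vec_def data_proj_def S)
  have "x i \<in> c i" using add.prems by simp
  moreover have "(\<Sum>k\<in>c i. n_vec D i S j k) = n_tot D S j" using add by simp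
  ultimately show ?case
    using assms(1) by (simp add: step sum.distrib n_tot_def data_proj_def)
qed

end

theory Submission imports Defs
begin

text \<open>\<open>exp (h_fun K m \<alpha>)\<close> is the probability of a sequence with counts \<open>m\<close> under a
  Dirichlet-multinomial model. By the chain rule, a sequence composed of blocks, one for each
  configuration of all parents, has the probability of an arbitrarily chosen first block, times the
  conditional probabilities of the others. Each of these is a mixture of likelihoods, hence at most
  the maximal likelihood of its block. The first block is bounded in three ways: by the maximal
  likelihood, by the Polya urn scheme, and by its own probability at a larger \<open>\<alpha>\<close>, which is
  legitimate because a nonnegative derivative at some \<open>\<alpha> \<le> 1\<close> persists at all smaller values.
  All three bounds remain valid when \<open>\<alpha>\<close> decreases, so they survive passing to supersets.\<close>

section \<open>Rising factorials and closed forms of the log likelihoods\<close>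

lemma Gamma_ratio_of_nat:
  assumes "\<alpha> > 0"
  shows "Gamma_ratio \<alpha> (real n) = pochhammer \<alpha> n"
proof -
  have "\<alpha> \<notin> \<int>\<^sub>\<le>\<^sub>0" using assms nonpos_Ints_nonpos[of \<alpha>] by auto
  then show ?thesis by (simp add: Gamma_ratio_def add.commute pochhammer_Gamma)
qed

lemma h_fun_pochhammer:
  assumes "finite K" "K \<noteq> {}" "\<alpha> > 0"
  shows "h_fun K m \<alpha> =
    (\<Sum>k\<in>K. ln (pochhammer (\<alpha> / real (card K)) (m k))) - ln (pochhammer \<alpha> (sum m K))"
proof -
  have "\<alpha> / real (card K) > 0" using assms by (simp add: card_gt_0_iff)
  then show ?thesis
    using assms by (simp add: h_fun_def Gamma_ratio_of_nat del: of_nat_sum)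
qed

text \<open>Here the total enters through a term of the same shape as the others, so nested splits
  of the categories telescope.\<close>

lemma max_loglik_alt:
  assumes "finite K"
  shows "max_loglik K m =
    (\<Sum>k\<in>K. real (m k) * ln (real (m k))) - real (sum m K) * ln (real (sum m K))"
proof -
  have "real (m k) * ln (real (m k) / real (sum m K))
      = real (m k) * ln (real (m k)) - real (m k) * ln (real (sum m K))" if "k \<in> K" for k
  proof (cases "m k = 0")
    case False
    have "m k \<le> sum m K" using assms that by (simp add: member_le_sum)
    with False have "sum m K > 0" by simp
    then show ?thesis using False by (simp add: ln_div right_diff_distrib del: of_nat_sum)
  qed simp
  then show ?thesis
    by (simp add: max_loglik_def sum_subtractf flip: sum_distrib_right)
qed

section \<open>Mixtures of likelihoods, the maximal likelihood and the chain rule\<close>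

text \<open>One summand of Gibbs' inequality, from \<open>ln z \<le> z - 1\<close> at
  \<open>z = y / a\<close>.\<close>

lemma mult_ln_le:
  fixes a y :: real
  assumes "a \<ge> 0" "y > 0"
  shows "a * ln y \<le> a * ln a + y - a"
proof (cases "a = 0")
  case False
  with assms have "a > 0" by simp
  then have "a * ln (y / a) \<le> a * (y / a - 1)"
    using assms by (intro mult_left_mono ln_le_minus_one) auto
  then show ?thesis using \<open>a > 0\<close> assms by (simp add: ln_div algebra_simps)
qed (use assms in simp)

lemma bernoulli_likelihood_le:
  fixes \<theta> :: real
  assumes "0 < \<theta>" "\<theta> < 1"
  shows "\<theta> ^ a * (1 - \<theta>) ^ b
    \<le> exp (real a * ln (real a) + real b * ln (real b) - real (a + b) * ln (real (a + b)))"
proof (cases "a + b = 0")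
  case False
  \<comment> \<open>Scaling the two probabilities by \<open>M\<close> makes their total
    \<open>a + b\<close>, so the linear terms of \<open>mult_ln_le\<close> cancel.\<close>
  define M where "M = real (a + b)"
  have M: "M > 0" using False unfolding M_def of_nat_0_less_iff by simp
  have "real a * ln (\<theta> * M) \<le> real a * ln (real a) + \<theta> * M - real a"
    using assms M by (intro mult_ln_le) auto
  moreover have "real b * ln ((1 - \<theta>) * M) \<le> real b * ln (real b) + (1 - \<theta>) * M - real b"
    using assms M by (intro mult_ln_le) auto
  moreover have "ln (\<theta> * M) = ln \<theta> + ln M" "ln ((1 - \<theta>) * M) = ln (1 - \<theta>) + ln M"
    using assms M by (auto simp: ln_mult)
  ultimately have "real a * ln \<theta> + real b * ln (1 - \<theta>)
      \<le> real a * ln (real a) + real b * ln (real b) - M * ln M"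
    by (simp add: M_def algebra_simps)
  moreover have "\<theta> ^ a * (1 - \<theta>) ^ b = exp (real a * ln \<theta> + real b * ln (1 - \<theta>))"
    using assms by (simp add: exp_add exp_of_nat_mult)
  ultimately show ?thesis by (simp add: M_def)
qed simp

text \<open>The left-hand side is the log probability of a sequence under a Beta-Bernoulli mixture; a
  mixture of likelihoods is at most the maximal likelihood.\<close>

lemma beta_bernoulli_le:
  fixes x y :: real
  assumes "x > 0" "y > 0"
  shows "ln (pochhammer x a) + ln (pochhammer y b) - ln (pochhammer (x + y) (a + b))
    \<le> real a * ln (real a) + real b * ln (real b) - real (a + b) * ln (real (a + b))" (is "_ \<le> ?R")
proof -
  have "((\<lambda>t. t powr (x - 1) * (1 - t) powr (y - 1)) has_integral Beta x y) {0..1}"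
    using assms by (rule has_integral_Beta_real)
  then have I: "((\<lambda>t. exp ?R * (t powr (x - 1) * (1 - t) powr (y - 1))) has_integral
      exp ?R * Beta x y) {0..1}"
    by (rule has_integral_mult_right)
  have I': "((\<lambda>t. t powr (x + a - 1) * (1 - t) powr (y + b - 1)) has_integral
      Beta (x + a) (y + b)) {0..1}"
    using assms by (intro has_integral_Beta_real) auto
  have "t powr (x + a - 1) * (1 - t) powr (y + b - 1)
      \<le> exp ?R * (t powr (x - 1) * (1 - t) powr (y - 1))" if "t \<in> {0..1}" for t
  \<comment> \<open>At the endpoints both sides vanish because \<open>0 powr z = 0\<close> for every
    \<open>z\<close>.\<close>
  proof (cases "t = 0 \<or> t = 1")
    case False
    then have t: "0 < t" "t < 1" using that by auto
    have "t powr (x + a - 1) * (1 - t) powr (y + b - 1)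
        = (t ^ a * (1 - t) ^ b) * (t powr (x - 1) * (1 - t) powr (y - 1))"
      using t by (simp add: powr_add powr_diff powr_realpow)
    also have "\<dots> \<le> exp ?R * (t powr (x - 1) * (1 - t) powr (y - 1))"
      using bernoulli_likelihood_le[OF t] by (intro mult_right_mono) auto
    finally show ?thesis .
  qed auto
  with I' I have "Beta (x + a) (y + b) \<le> exp ?R * Beta x y"
    by (rule has_integral_le)
  moreover have "Beta (x + a) (y + b)
      = pochhammer x a * pochhammer y b / pochhammer (x + y) (a + b) * Beta x y"
  proof -
    have "Gamma (z + real n) = pochhammer z n * Gamma z" if "z > 0" for z :: real and n
      using Gamma_ratio_of_nat[OF that, of n] Gamma_real_pos[OF that]
      by (simp add: Gamma_ratio_def field_simps)
    from this[of x a] this[of y b] this[of "x + y" "a + b"] show ?thesis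
      using assms by (simp add: Beta_def add_ac)
  qed
  moreover have "Beta x y > 0" using assms by (simp add: Beta_def)
  ultimately have "pochhammer x a * pochhammer y b / pochhammer (x + y) (a + b) \<le> exp ?R"
    by (simp only: mult_le_cancel_right_pos)
  moreover have "pochhammer x a > 0" "pochhammer y b > 0" "pochhammer (x + y) (a + b) > 0"
    using assms by (auto intro!: pochhammer_pos)
  ultimately have "ln (pochhammer x a * pochhammer y b / pochhammer (x + y) (a + b)) \<le> ln (exp ?R)"
    by (intro ln_mono divide_pos_pos mult_pos_pos) auto
  then show ?thesis
    using assms by (simp add: ln_mult ln_div pochhammer_pos less_imp_neq[symmetric])
qed

text \<open>Merging all categories but one leaves a Beta-Bernoulli pair; the merged part is handled
  by induction, and the terms of its total cancel.\<close>

lemma dirichlet_multinomial_le: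
  fixes x :: "'a \<Rightarrow> real"
  assumes "finite K" "K \<noteq> {}" "\<And>k. k \<in> K \<Longrightarrow> x k > 0"
  shows "(\<Sum>k\<in>K. ln (pochhammer (x k) (m k))) - ln (pochhammer (sum x K) (sum m K))
    \<le> max_loglik K m"
  unfolding max_loglik_alt[OF assms(1)]
  using assms
proof (induction K rule: finite_ne_induct)
  case (insert k K)
  have "sum x K > 0" using insert by (intro sum_pos) auto
  then have "ln (pochhammer (x k) (m k)) + ln (pochhammer (sum x K) (sum m K))
      - ln (pochhammer (x k + sum x K) (m k + sum m K))
    \<le> real (m k) * ln (real (m k)) + real (sum m K) * ln (real (sum m K))
      - real (m k + sum m K) * ln (real (m k + sum m K))"
    using insert.prems by (intro beta_bernoulli_le) auto
  then show ?case using insert by (simp del: of_nat_sum of_nat_add)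
qed simp

lemma max_loglik_nonpos:
  assumes "finite K"
  shows "max_loglik K m \<le> 0"
  unfolding max_loglik_def
proof (intro sum_nonpos mult_nonneg_nonpos)
  fix k assume "k \<in> K"
  then have "m k \<le> sum m K" using assms by (simp add: member_le_sum)
  then show "ln (real (m k) / real (sum m K)) \<le> 0"
    by (cases "m k = 0") (auto simp del: of_nat_sum)
qed simp

text \<open>Chain rule: conditioned on the counts \<open>a\<close>, the remaining observations follow a
  Dirichlet-multinomial with updated parameters.\<close>

lemma h_fun_add_le:
  assumes "finite K" "K \<noteq> {}" "\<alpha> > 0"
  shows "h_fun K (\<lambda>k. a k + m k) \<alpha> \<le> h_fun K a \<alpha> + max_loglik K m"
proof -
  have pos: "\<alpha> / real (card K) > 0" using assms by (simp add: card_gt_0_iff)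
  have split: "ln (pochhammer x (r + s)) = ln (pochhammer x r) + ln (pochhammer (x + real r) s)"
    if "x > 0" for x :: real and r s
    using that by (subst pochhammer_product') (auto simp: ln_mult pochhammer_pos less_imp_neq[symmetric])
  have "(\<Sum>k\<in>K. \<alpha> / real (card K) + real (a k)) = \<alpha> + real (sum a K)"
    using assms by (simp add: sum.distrib)
  then have "(\<Sum>k\<in>K. ln (pochhammer (\<alpha> / real (card K) + real (a k)) (m k)))
      - ln (pochhammer (\<alpha> + real (sum a K)) (sum m K)) \<le> max_loglik K m"
    using dirichlet_multinomial_le[OF assms(1,2), of "\<lambda>k. \<alpha> / real (card K) + real (a k)" m] pos
    by (simp add: add_pos_nonneg)
  then show ?thesis
    using assms pos by (simp add: h_fun_pochhammer split sum.distrib del: of_nat_sum)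
qed

lemma h_fun_zero:
  assumes "finite K" "K \<noteq> {}" "\<alpha> > 0"
  shows "h_fun K (\<lambda>k. 0) \<alpha> = 0"
  using assms by (simp add: h_fun_pochhammer)

lemma h_fun_le_max_loglik:
  assumes "finite K" "K \<noteq> {}" "\<alpha> > 0"
  shows "h_fun K m \<alpha> \<le> max_loglik K m"
  using h_fun_add_le[OF assms, of "\<lambda>k. 0" m] h_fun_zero[OF assms] by simp

text \<open>The counts ignore the order of the blocks, so any \<open>j0\<close> can come first and
  keep its exact probability while the chain rule is iterated over the others.\<close>

lemma h_fun_sum_le:
  assumes "finite K" "K \<noteq> {}" "\<alpha> > 0" "finite J" "j0 \<in> J"
  shows "h_fun K (\<lambda>k. \<Sum>j\<in>J. m j k) \<alpha>
    \<le> h_fun K (m j0) \<alpha> + (\<Sum>j\<in>J - {j0}. max_loglik K (m j))"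
proof -
  have "h_fun K (\<lambda>k. m j0 k + (\<Sum>j\<in>I. m j k)) \<alpha>
      \<le> h_fun K (m j0) \<alpha> + (\<Sum>j\<in>I. max_loglik K (m j))" if "finite I" for I
    using that
  proof (induction I)
    case (insert j I)
    have "h_fun K (\<lambda>k. m j0 k + (\<Sum>j\<in>insert j I. m j k)) \<alpha>
        = h_fun K (\<lambda>k. (m j0 k + (\<Sum>j\<in>I. m j k)) + m j k) \<alpha>"
      using insert by (simp add: add_ac)
    also have "\<dots> \<le> h_fun K (\<lambda>k. m j0 k + (\<Sum>j\<in>I. m j k)) \<alpha> + max_loglik K (m j)"
      using assms(1-3) by (rule h_fun_add_le)
    finally show ?case using insert by simp
  qed simp
  from this[of "J - {j0}"] show ?thesis
    using assms(4,5) by (simp add: sum.remove[of J j0])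
qed

section \<open>Dependence of \<open>h_fun\<close> on \<open>\<alpha>\<close>\<close>

lemma ln_pochhammer:
  fixes x :: real
  assumes "x > 0"
  shows "ln (pochhammer x n) = (\<Sum>t<n. ln (x + real t))"
  using assms by (simp add: pochhammer_prod ln_prod atLeast0LessThan add_pos_nonneg)

lemma h_fun_has_derivative:
  assumes "finite K" "K \<noteq> {}" "\<alpha> > 0"
  shows "(h_fun K m has_field_derivative
    (\<Sum>k\<in>K. \<Sum>t<m k. 1 / (\<alpha> + real (card K * t))) - (\<Sum>t<sum m K. 1 / (\<alpha> + real t))) (at \<alpha>)"
proof -
  define Q where "Q = real (card K)"
  have Q: "Q > 0" using assms by (simp add: Q_def card_gt_0_iff)
  have "((\<lambda>x. (\<Sum>k\<in>K. \<Sum>t<m k. ln (x / Q + real t)) - (\<Sum>t<sum m K. ln (x + real t)))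
      has_field_derivative
      (\<Sum>k\<in>K. \<Sum>t<m k. 1 / (\<alpha> / Q + real t) * (1 / Q)) - (\<Sum>t<sum m K. 1 / (\<alpha> + real t))) (at \<alpha>)"
    using assms Q by (auto intro!: derivative_eq_intros simp: add_pos_nonneg)
  moreover have "1 / (\<alpha> / Q + real t) * (1 / Q) = 1 / (\<alpha> + real (card K * t))" for t
    using Q by (simp add: field_simps Q_def)
  ultimately have D: "((\<lambda>x. (\<Sum>k\<in>K. \<Sum>t<m k. ln (x / Q + real t)) - (\<Sum>t<sum m K. ln (x + real t)))
      has_field_derivative
      (\<Sum>k\<in>K. \<Sum>t<m k. 1 / (\<alpha> + real (card K * t))) - (\<Sum>t<sum m K. 1 / (\<alpha> + real t))) (at \<alpha>)"
    by simp
  have "h_fun K m x = (\<Sum>k\<in>K. \<Sum>t<m k. ln (x / Q + real t)) - (\<Sum>t<sum m K. ln (x + real t))"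
    if "x > 0" for x
    using assms that Q by (simp add: h_fun_pochhammer ln_pochhammer flip: Q_def)
  then show ?thesis
    using assms by (intro has_field_derivative_transform_within_open[OF D, of "{0<..}"]) auto
qed

text \<open>The \<open>r\<close>-th smallest of the numbers \<open>card K * t\<close> on the left is at least \<open>r\<close>.\<close>

lemma sum_multiples_le:
  fixes \<psi> :: "nat \<Rightarrow> real"
  assumes "finite K" and "\<And>s t. 1 \<le> s \<Longrightarrow> s \<le> t \<Longrightarrow> \<psi> t \<le> \<psi> s"
  shows "(\<Sum>k\<in>K. \<Sum>t=1..p k. \<psi> (card K * t)) \<le> (\<Sum>t=1..sum p K. \<psi> t)"
proof (induction "sum p K" arbitrary: p)
  case 0
  then have "p k = 0" if "k \<in> K" for k using assms(1) that by simp
  then show ?case using 0 by simp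
next
  case (Suc N)
  then have "K \<noteq> {}" by auto
  \<comment> \<open>The largest multiple \<open>card K * M\<close> is removed: it is at least
    \<open>sum p K\<close>, so its term is at most \<open>\<psi> (Suc N)\<close>, and the induction
    hypothesis covers the rest.\<close>
  define M where "M = Max (p ` K)"
  obtain a where a: "a \<in> K" "p a = M"
    using Max_in[of "p ` K"] assms(1) \<open>K \<noteq> {}\<close> unfolding M_def by fastforce
  have "p k \<le> M" if "k \<in> K" for k using assms(1) that by (simp add: M_def)
  then have le: "sum p K \<le> card K * M" using sum_bounded_above[of K p M] by simp
  with Suc have "M > 0" by (cases M) auto
  define r where "r = p(a := M - 1)"
  have r: "sum r (K - {a}) = sum p (K - {a})"
    "(\<Sum>k\<in>K - {a}. \<Sum>t=1..r k. \<psi> (card K * t)) = (\<Sum>k\<in>K - {a}. \<Sum>t=1..p k. \<psi> (card K * t))"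
    by (auto intro!: sum.cong simp: r_def)
  have "sum p K = p a + sum p (K - {a})" "sum r K = r a + sum r (K - {a})"
    using assms(1) a by (auto simp: sum.remove)
  then have N: "N = sum r K" using r(1) a \<open>M > 0\<close> Suc.hyps(2) by (simp add: r_def)
  obtain M' where M': "M = Suc M'" using \<open>M > 0\<close> by (cases M) auto
  have "(\<Sum>k\<in>K. \<Sum>t=1..p k. \<psi> (card K * t)) = (\<Sum>k\<in>K. \<Sum>t=1..r k. \<psi> (card K * t)) + \<psi> (card K * M)"
    using assms(1) a r(2) M' by (simp add: sum.remove[of K a] r_def)
  also have "\<dots> \<le> (\<Sum>t=1..N. \<psi> t) + \<psi> (Suc N)"
    using Suc.hyps(1)[OF N] le N Suc.hyps(2) assms(2)[of "Suc N" "card K * M"] by simp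
  also have "\<dots> = (\<Sum>t=1..sum p K. \<psi> t)" by (simp flip: Suc.hyps(2))
  finally show ?case .
qed

text \<open>On \<open>(0, 1]\<close> the function \<open>x \<mapsto> x h'(x)\<close> is antitone, so a nonnegative derivative at \<open>\<alpha>\<close>
  stays nonnegative to the left of \<open>\<alpha>\<close>. The difference of two of its values is a sum over
  \<open>\<psi> t = t (\<alpha> - \<beta>) / ((\<alpha> + t) (\<beta> + t))\<close>, which decreases in \<open>t \<ge> 1 \<ge> sqrt (\<alpha> \<beta>)\<close>.\<close>

lemma h_fun_deriv_nonneg:
  assumes K: "finite K" "K \<noteq> {}" and "0 < \<beta>" "\<beta> \<le> \<alpha>" "\<alpha> \<le> 1" and "deriv (h_fun K m) \<alpha> \<ge> 0"
  shows "deriv (h_fun K m) \<beta> \<ge> 0"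
proof -
  define \<phi> where "\<phi> x = (\<Sum>k\<in>K. \<Sum>t<m k. x / (x + real (card K * t))) - (\<Sum>t<sum m K. x / (x + real t))"
    for x :: real
  have \<phi>: "\<phi> x = x * deriv (h_fun K m) x" if "x > 0" for x
    using DERIV_imp_deriv[OF h_fun_has_derivative[OF K that, of m]]
    by (simp add: \<phi>_def right_diff_distrib sum_distrib_left)
  define \<psi> where "\<psi> t = \<alpha> / (\<alpha> + real t) - \<beta> / (\<beta> + real t)" for t :: nat
  have \<psi>: "\<psi> t = (\<alpha> - \<beta>) * (real t / ((\<alpha> + real t) * (\<beta> + real t)))" for t
    using assms by (simp add: \<psi>_def field_simps add_pos_nonneg)
  have \<psi>0: "\<psi> 0 = 0" and nonneg: "\<psi> t \<ge> 0" for t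
    using assms by (auto simp: \<psi>)
  have anti: "\<psi> t \<le> \<psi> s" if "1 \<le> s" "s \<le> t" for s t
  proof -
    have "\<alpha> * \<beta> \<le> 1 * 1" using assms by (intro mult_mono) auto
    also have "\<dots> \<le> real s * real t" using that by (intro mult_mono) auto
    finally have "0 \<le> (real t - real s) * (real s * real t - \<alpha> * \<beta>)" using that by simp
    then have "real t * ((\<alpha> + real s) * (\<beta> + real s)) \<le> real s * ((\<alpha> + real t) * (\<beta> + real t))"
      by (simp add: algebra_simps)
    then have "real t / ((\<alpha> + real t) * (\<beta> + real t)) \<le> real s / ((\<alpha> + real s) * (\<beta> + real s))"
      using assms by (simp add: divide_simps add_pos_nonneg mult_pos_pos)
    then show ?thesis unfolding \<psi> using assms by (intro mult_left_mono) auto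
  qed
  \<comment> \<open>Monotonicity of \<open>\<psi>\<close> is available from \<open>t = 1\<close> on,
    so the vanishing terms at \<open>t = 0\<close> are removed. Each nonempty category loses one
    term and a nonzero total loses only one, which leaves enough room on the right.\<close>
  have drop0: "(\<Sum>t<n. w t) = (\<Sum>t=1..n - 1. w t)" if "w 0 = 0" for n and w :: "nat \<Rightarrow> real"
    by (rule sum.mono_neutral_right) (use that in \<open>auto simp: Suc_le_eq intro: gr0I\<close>)
  have "(\<Sum>k\<in>K. \<Sum>t<m k. \<psi> (card K * t)) = (\<Sum>k\<in>K. \<Sum>t=1..m k - 1. \<psi> (card K * t))"
    by (intro sum.cong refl drop0) (simp add: \<psi>0)
  also have "\<dots> \<le> (\<Sum>t=1..(\<Sum>k\<in>K. m k - 1). \<psi> t)"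
    using K(1) anti by (rule sum_multiples_le)
  also have "\<dots> \<le> (\<Sum>t=1..sum m K - 1. \<psi> t)"
  proof -
    have "(\<Sum>k\<in>K. m k - 1) \<le> sum m K - 1"
    proof (cases "sum m K = 0")
      case False
      then obtain b where "b \<in> K" "m b > 0" using K(1) by auto
      then have "(\<Sum>k\<in>K. m k - 1) < sum m K" using K(1) by (intro sum_strict_mono_ex1) (auto intro!: bexI[of _ b])
      then show ?thesis by simp
    qed (use K(1) in simp)
    then show ?thesis using nonneg by (intro sum_mono2) auto
  qed
  also have "\<dots> = (\<Sum>t<sum m K. \<psi> t)" by (simp add: drop0 \<psi>0)
  finally have "\<phi> \<alpha> \<le> \<phi> \<beta>"
    by (simp add: \<phi>_def \<psi>_def sum_subtractf)
  moreover have "\<phi> \<alpha> \<ge> 0" using assms by (simp add: \<phi>)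
  ultimately have "0 \<le> \<phi> \<beta>" by linarith
  then have "0 \<le> \<beta> * deriv (h_fun K m) \<beta>" using assms by (simp add: \<phi>)
  then show ?thesis using assms by (simp add: zero_le_mult_iff)
qed

text \<open>Where \<open>h_bar\<close> is the value of \<open>h_fun\<close>, the derivative is
  nonnegative on all of \<open>[\<beta>, \<alpha>]\<close>; otherwise 0 is a bound because
  \<open>h_fun\<close> is the logarithm of a probability.\<close>

lemma h_fun_le_h_bar:
  assumes K: "finite K" "K \<noteq> {}" and "0 < \<beta>" "\<beta> \<le> \<alpha>"
  shows "h_fun K m \<beta> \<le> h_bar K m \<alpha>"
proof (cases "\<alpha> \<le> 1 \<and> deriv (h_fun K m) \<alpha> \<ge> 0")
  case True
  have "h_fun K m \<beta> \<le> h_fun K m \<alpha>"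
  proof (rule DERIV_nonneg_imp_nondecreasing[of \<beta> \<alpha> "h_fun K m"])
    fix x assume "\<beta> \<le> x" "x \<le> \<alpha>"
    then have "x > 0" "deriv (h_fun K m) x \<ge> 0"
      using assms True h_fun_deriv_nonneg[OF K, of x \<alpha> m] by auto
    moreover have "DERIV (h_fun K m) x :> deriv (h_fun K m) x"
      using h_fun_has_derivative[OF K \<open>x > 0\<close>, of m] by (simp add: DERIV_imp_deriv)
    ultimately show "\<exists>y. DERIV (h_fun K m) x :> y \<and> y \<ge> 0" by blast
  qed fact
  then show ?thesis using True by (simp add: h_bar_def)
next
  case False
  then show ?thesis
    using h_fun_le_max_loglik[OF K assms(3), of m] max_loglik_nonpos[OF K(1), of m]
    by (auto simp: h_bar_def)
qed

section \<open>The Polya urn bound\<close>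

lemma ln_pochhammer_mono:
  fixes x y :: real
  assumes "0 < x" "x \<le> y"
  shows "ln (pochhammer x n) \<le> ln (pochhammer y n)"
  using assms by (simp add: ln_pochhammer sum_mono)

text \<open>Consider the sequence of observations in which equal values are consecutive. The first
  observation of a new value has conditional probability \<open>(1 / Q) / (1 + N / \<alpha>)\<close>, where \<open>N\<close> is
  the number of previous observations; all other factors are bounded by 1.\<close>

lemma polya_urn_le:
  fixes Q \<alpha> :: real
  assumes "Q \<ge> 1" "\<alpha> > 0" "\<forall>x\<in>set xs. 0 < x"
  shows "(\<Sum>x\<leftarrow>xs. ln (pochhammer (\<alpha> / Q) x)) - ln (pochhammer \<alpha> (sum_list xs))
    \<le> - real (length xs) * ln Q - (\<Sum>x\<leftarrow>butlast xs. ln (1 + real x / \<alpha>))"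
  using assms(3)
proof (induction xs rule: rev_induct)
  case (snoc x xs)
  define N where "N = sum_list xs"
  obtain y where y: "x = Suc y" using snoc.prems by (cases x) auto
  have rec: "ln (pochhammer z (Suc y)) = ln z + ln (pochhammer (z + 1) y)" if "z > 0" for z :: real
    using that by (simp add: pochhammer_rec ln_mult pochhammer_pos less_imp_neq[symmetric])
  have "ln (pochhammer \<alpha> (N + x)) = ln (pochhammer \<alpha> N) + ln (pochhammer (\<alpha> + real N) x)"
    using assms(2)
    by (simp add: pochhammer_product' ln_mult pochhammer_pos add_pos_nonneg less_imp_neq[symmetric])
  moreover have "\<alpha> / Q \<le> \<alpha> + real N" "\<alpha> / Q > 0"
    using assms by (auto simp: field_simps add_increasing2)
  then have "ln (pochhammer (\<alpha> / Q) x) - ln (pochhammer (\<alpha> + real N) x)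
      \<le> ln (\<alpha> / Q) - ln (\<alpha> + real N)"
    using rec[of "\<alpha> / Q"] rec[of "\<alpha> + real N"] assms(2)
      ln_pochhammer_mono[of "\<alpha> / Q + 1" "\<alpha> + real N + 1" y]
    by (simp add: y add_pos_nonneg del: pochhammer_Suc)
  moreover have "ln (\<alpha> / Q) - ln (\<alpha> + real N) = - ln Q - ln (1 + real N / \<alpha>)"
  proof -
    have "\<alpha> + real N = \<alpha> * (1 + real N / \<alpha>)" using assms(2) by (simp add: field_simps)
    moreover have "1 + real N / \<alpha> > 0" using assms(2) by (intro add_pos_nonneg) auto
    ultimately show ?thesis using assms by (simp add: ln_mult ln_div)
  qed
  \<comment> \<open>Since \<open>butlast (xs @ [x]) = xs\<close>, the sum gains a term for the last
    entry of \<open>xs\<close>, which is at most \<open>N\<close>. For empty \<open>xs\<close> both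
    sides are 0.\<close>
  moreover have "(\<Sum>x\<leftarrow>xs. ln (1 + real x / \<alpha>))
      \<le> (\<Sum>x\<leftarrow>butlast xs. ln (1 + real x / \<alpha>)) + ln (1 + real N / \<alpha>)"
  proof (cases "xs = []")
    case False
    then have xs: "xs = butlast xs @ [last xs]" by simp
    have "last xs \<le> N" using False by (simp add: N_def member_le_sum_list)
    then have "ln (1 + real (last xs) / \<alpha>) \<le> ln (1 + real N / \<alpha>)"
      using assms(2) by (intro ln_mono add_left_mono divide_right_mono add_pos_nonneg) auto
    moreover have "(\<Sum>x\<leftarrow>xs. ln (1 + real x / \<alpha>))
        = (\<Sum>x\<leftarrow>butlast xs. ln (1 + real x / \<alpha>)) + ln (1 + real (last xs) / \<alpha>)"
      by (subst (1) xs) simp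
    ultimately show ?thesis by simp
  qed (simp add: N_def)
  ultimately show ?case
    using snoc by (simp add: N_def algebra_simps)
qed simp

section \<open>The urn bound in terms of the data counts\<close>

lemma sum_list_counts_desc:
  assumes "finite K"
  shows "(\<Sum>x\<leftarrow>counts_desc K m. F x) = (\<Sum>k\<in>K. F (m k))"
proof -
  have "(\<Sum>x\<leftarrow>counts_desc K m. F x) = sum_mset (mset (map F (counts_desc K m)))"
    by (simp only: sum_mset_sum_list)
  also have "\<dots> = sum_mset (image_mset (\<lambda>k. F (m k)) (mset_set K))"
    by (simp add: counts_desc_def multiset.map_comp comp_def)
  finally show ?thesis by (simp add: sum_unfold_sum_mset)
qed

text \<open>The positive entries of a non-increasing list form an initial segment; a positive entry
  ensures that the maximum in \<open>last_pos\<close> exists.\<close>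

lemma filter_pos_eq_take_last_pos:
  assumes "sorted_wrt (\<ge>) ns" "\<exists>x\<in>set ns. 0 < x"
  shows "last_pos ns = length (filter (\<lambda>x. 0 < x) ns)"
    and "filter (\<lambda>x. 0 < x) ns = take (last_pos ns) ns"
proof -
  let ?P = "\<lambda>x::nat. 0 < x"
  have eq: "filter ?P ns = takeWhile ?P ns"
    using assms(1) by (induction ns) auto
  define k where "k = length (takeWhile ?P ns)"
  have "takeWhile ?P ns \<noteq> []" using assms(2) eq by (auto simp: filter_empty_conv simp flip: eq)
  then have k: "1 \<le> k" "k \<le> length ns"
    by (auto simp: k_def Suc_le_eq length_takeWhile_le)
  have *: "last_pos ns = k"
    unfolding last_pos_def
  proof (rule Greatest_equality)
    have "takeWhile ?P ns ! (k - 1) \<in> set (takeWhile ?P ns)" using k by (simp add: k_def)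
    then have "?P (takeWhile ?P ns ! (k - 1))" by (blast dest: set_takeWhileD)
    then show "k \<in> {1..length ns} \<and> ns ! (k - 1) > 0"
      using k by (simp add: k_def takeWhile_nth)
  next
    fix l assume l: "l \<in> {1..length ns} \<and> ns ! (l - 1) > 0"
    show "l \<le> k"
    proof (rule ccontr)
      assume "\<not> l \<le> k"
      then have "k < length ns" "k \<le> l - 1" using l by auto
      \<comment> \<open>Index \<open>k\<close> is position \<open>k + 1\<close>, the first one past
        the positive segment.\<close>
      then have "ns ! k = 0" unfolding k_def using nth_length_takeWhile[of ?P ns] by simp
      moreover have "ns ! (l - 1) \<le> ns ! k"
        using assms(1) \<open>k \<le> l - 1\<close> l by (cases "k = l - 1") (auto simp: sorted_wrt_iff_nth_less)
      ultimately show False using l by simp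
    qed
  qed
  show "last_pos ns = length (filter ?P ns)" by (simp add: * eq k_def)
  show "filter ?P ns = take (last_pos ns) ns" by (simp add: * eq k_def flip: takeWhile_eq_take)
qed

lemma g_bound_mono:
  assumes "0 < \<beta>" "\<beta> \<le> \<alpha>"
  shows "g_bound c D i S j \<beta> \<le> g_bound c D i S j \<alpha>"
  unfolding g_bound_def Let_def neg_le_iff_le
  using assms by (intro sum_mono ln_mono add_left_mono divide_left_mono add_pos_nonneg) auto

text \<open>An observed configuration above \<open>j\<close> is determined by its child state, and
  the count of that state is positive.\<close>

lemma card_data_u_at_le:
  assumes "finite (c i)" "\<And>x. x \<in># D \<Longrightarrow> x i \<in> c i"
  shows "card (data_u_at D i S j) \<le> card {k \<in> c i. 0 < n_vec D i S j k}"
proof (rule card_inj_on_le)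
  show "inj_on (\<lambda>x. x i) (data_u_at D i S j)"
  proof (rule inj_onI)
    fix x y assume xy: "x \<in> data_u_at D i S j" "y \<in> data_u_at D i S j" "x i = y i"
    then have ext: "x \<in> extensional (S \<union> {i})" "y \<in> extensional (S \<union> {i})"
      and "restrict x S = restrict y S"
      by (auto simp: data_u_at_def data_u_def data_proj_def)
    have "x v = y v" if "v \<in> S \<union> {i}" for v
      using fun_cong[OF \<open>restrict x S = restrict y S\<close>, of v] that xy(3) by (auto split: if_splits)
    then show "x = y" using ext by (intro extensionalityI)
  qed
  show "(\<lambda>x. x i) ` data_u_at D i S j \<subseteq> {k \<in> c i. 0 < n_vec D i S j k}"
  proof clarify
    fix x assume "x \<in> data_u_at D i S j"
    then have x: "x \<in># data_proj D (S \<union> {i})" "restrict x S = j"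
      by (auto simp: data_u_at_def data_u_def)
    then have "x i \<in> c i" using assms(2) by (auto simp: data_proj_def)
    moreover have "x \<in># {#y \<in># data_proj D (S \<union> {i}). restrict y S = j \<and> y i = x i#}"
      using x by simp
    then have "0 < n_vec D i S j (x i)"
      unfolding n_vec_def by (cases rule: mset_add) simp
    ultimately show "x i \<in> c i \<and> 0 < n_vec D i S j (x i)" by simp
  qed
  show "finite {k \<in> c i. 0 < n_vec D i S j k}" using assms(1) by simp
qed

lemma h_fun_le_f_plus_g:
  assumes K: "finite (c i)" "c i \<noteq> {}" and D: "\<And>x. x \<in># D \<Longrightarrow> x i \<in> c i"
    and j: "j \<in> data_u D S" and "\<alpha> > 0"
  shows "h_fun (c i) (n_vec D i S j) \<alpha> \<le> f_bound c D i S j + g_bound c D i S j \<alpha>"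
proof -
  define m where "m = n_vec D i S j"
  define Q where "Q = real (card (c i))"
  have Q: "Q \<ge> 1" using K by (simp add: Q_def Suc_le_eq card_gt_0_iff)
  define ns where "ns = counts_desc (c i) m"
  define xs where "xs = filter (\<lambda>x. 0 < x) ns"
  \<comment> \<open>The urn bound needs positive entries; zero counts contribute nothing to
    \<open>h_fun\<close>, since \<open>pochhammer x 0 = 1\<close>.\<close>
  have sum_xs: "(\<Sum>x\<leftarrow>xs. F x) = (\<Sum>k\<in>c i. F (m k))" if "F 0 = 0" for F :: "nat \<Rightarrow> 'b::comm_monoid_add"
  proof -
    have "(\<Sum>x\<leftarrow>xs. F x) = (\<Sum>x\<leftarrow>ns. F x)"
      unfolding xs_def by (rule sum_list_map_filter) (use that in auto)
    then show ?thesis using sum_list_counts_desc[OF K(1)] by (simp add: ns_def)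
  qed
  have "sum m (c i) > 0"
    using j K(1) D by (simp add: m_def sum_n_vec n_tot_def data_u_def)
  then obtain k where "k \<in> c i" "0 < m k"
    using sum.not_neutral_contains_not_neutral[of m "c i"] by auto
  then have "\<exists>x\<in>set ns. 0 < x"
    using K(1) by (auto simp: ns_def counts_desc_def intro!: bexI[of _ "m k"])
  moreover have "sorted_wrt (\<ge>) ns"
    by (simp add: ns_def counts_desc_def sorted_wrt_rev)
  ultimately have last: "last_pos ns = length xs" "xs = take (last_pos ns) ns"
    unfolding xs_def by (auto intro: filter_pos_eq_take_last_pos)
  have "length xs = size (filter_mset (\<lambda>x. 0 < x) (mset ns))"
    unfolding xs_def by (metis mset_filter size_mset)
  also have "\<dots> = card {k \<in> c i. 0 < m k}"
    using K(1) by (simp add: ns_def counts_desc_def filter_mset_image_mset filter_mset_mset_set)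
  finally have len: "length xs = card {k \<in> c i. 0 < m k}" .
  \<comment> \<open>\<open>last_pos\<close> counts the positive entries, so \<open>g_bound\<close>
    omits exactly the last of them, as \<open>butlast\<close> does.\<close>
  have "butlast xs ! l = ns ! l" if "l < length xs - 1" for l
  proof -
    have "butlast xs ! l = xs ! l" using that by (simp add: nth_butlast)
    also have "\<dots> = take (last_pos ns) ns ! l" using last(2) by (rule arg_cong)
    finally show ?thesis using that by (simp add: last(1))
  qed
  then have g: "g_bound c D i S j \<alpha> = - (\<Sum>x\<leftarrow>butlast xs. ln (1 + real x / \<alpha>))"
    by (simp add: g_bound_def sum_list_sum_nth atLeast0LessThan last(1) sum.atLeast1_atMost_eq
        flip: m_def ns_def)
  have "h_fun (c i) m \<alpha> \<le> - real (length xs) * ln Q - (\<Sum>x\<leftarrow>butlast xs. ln (1 + real x / \<alpha>))"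
    using polya_urn_le[OF Q \<open>\<alpha> > 0\<close>, of xs] K \<open>\<alpha> > 0\<close>
      sum_xs[of "\<lambda>x. ln (pochhammer (\<alpha> / Q) x)"] sum_xs[of "\<lambda>x. x"]
    by (simp add: h_fun_pochhammer xs_def flip: Q_def)
  moreover have "- real (length xs) * ln Q \<le> f_bound c D i S j"
  proof -
    have "card (data_u_at D i S j) \<le> length xs"
      unfolding len m_def using K(1) D by (rule card_data_u_at_le)
    then show ?thesis using Q by (simp add: f_bound_def mult_right_mono flip: Q_def)
  qed
  ultimately show ?thesis by (simp add: g m_def)
qed

section \<open>Refinement of configurations and scores on supersets\<close>

lemma size_filter_mset_partition:
  assumes "finite J" "\<And>y. y \<in># D \<Longrightarrow> P y \<Longrightarrow> g y \<in> J"
  shows "size {#y \<in># D. P y#} = (\<Sum>j\<in>J. size {#y \<in># D. P y \<and> g y = j#})"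
  using assms(2)
proof (induction D)
  case (add x D)
  have "size {#y \<in># add_mset x D. P y \<and> g y = j#}
      = size {#y \<in># D. P y \<and> g y = j#} + (if j = g x then if P x then 1 else 0 else 0)" for j
    by auto
  then show ?case using add assms(1) by (auto simp: sum.distrib)
qed simp

lemma n_vec_eq_size:
  "n_vec D i S j k = size {#x \<in># D. restrict x S = j \<and> x i = k#}"
  by (simp add: n_vec_def data_proj_def filter_mset_image_mset Int_absorb1 Int_absorb2 subset_insertI)

text \<open>Supplies the blocks for \<open>h_fun_sum_le\<close>: the observations at
  \<open>j\<close> are sorted by their configuration on \<open>T\<close>.\<close>

lemma n_vec_refine:
  assumes "S \<subseteq> T"
  shows "n_vec D i S j k = (\<Sum>x\<in>{x \<in> data_u D T. restrict x S = j}. n_vec D i T x k)"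
proof -
  let ?J = "{x \<in> data_u D T. restrict x S = j}"
  have T: "T \<inter> S = S" using assms by blast
  have "n_vec D i S j k
      = (\<Sum>x\<in>?J. size {#y \<in># D. (restrict y S = j \<and> y i = k) \<and> restrict y T = x#})"
    unfolding n_vec_eq_size
    by (rule size_filter_mset_partition) (auto simp: data_u_def data_proj_def T)
  also have "\<dots> = (\<Sum>x\<in>?J. n_vec D i T x k)"
    unfolding n_vec_eq_size
    by (intro sum.cong refl arg_cong[of _ _ size] filter_mset_cong) (auto simp: T)
  finally show ?thesis .
qed

text \<open>A parent set enters only through its counts and prior weight; passing to a superset
  splits the counts and never raises the argument of \<open>h_fun\<close>.\<close>

lemma LLBDeu_eq_h_fun:
  assumes "finite (c i)" "\<And>x. x \<in># D \<Longrightarrow> x i \<in> c i"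
  shows "LLBDeu \<alpha> c D i S j = h_fun (c i) (n_vec D i S j) (\<alpha> / real (q c S))"
proof -
  have "sum (n_vec D i S j) (c i) = n_tot D S j" using assms by (rule sum_n_vec)
  then show ?thesis by (simp add: LLBDeu_def h_fun_def del: of_nat_sum)
qed

lemma finite_data_u [simp]: "finite (data_u D S)"
  by (simp add: data_u_def)

lemma restrict_data_u:
  assumes "S \<subseteq> T" "j \<in> data_u D T"
  shows "restrict j S \<in> data_u D S"
  using assms by (auto simp: data_u_def data_proj_def Int_absorb1 Int_absorb2)

lemma data_u_fiber_nonempty:
  assumes "S \<subseteq> T" "j \<in> data_u D S"
  obtains x where "x \<in> data_u D T" "restrict x S = j"
proof -
  obtain y where y: "y \<in># D" "j = restrict y S"
    using assms(2) by (auto simp: data_u_def data_proj_def)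
  show ?thesis
    by (rule that[of "restrict y T"])
      (use y assms(1) in \<open>auto simp: data_u_def data_proj_def Int_absorb1\<close>)
qed

lemma q_pos:
  assumes "finite S" "\<And>v. v \<in> S \<Longrightarrow> finite (c v) \<and> c v \<noteq> {}"
  shows "q c S > 0"
  using assms by (auto simp: q_def card_PiE card_gt_0_iff intro!: prod_pos)

lemma q_mono:
  assumes "finite T" "S \<subseteq> T" "\<And>v. v \<in> T \<Longrightarrow> finite (c v) \<and> c v \<noteq> {}"
  shows "q c S \<le> q c T"
proof -
  have "finite S" using assms finite_subset by blast
  moreover have "(\<Prod>v\<in>S. card (c v)) \<le> (\<Prod>v\<in>T. card (c v))"
    using assms
    by (intro dvd_imp_le prod_dvd_prod_subset prod_pos) (auto simp: card_gt_0_iff)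
  ultimately show ?thesis using assms(1) by (simp add: q_def card_PiE)
qed

text \<open>For \<open>T = S\<close> this bounds a single score. Stating it for supersets avoids comparing
  \<open>h_under\<close> on different sets: \<open>h_under\<close> on \<open>S\<close> already absorbs the smaller prior weight of \<open>T\<close>,
  since each of the three bounds at \<open>\<alpha>\<close> dominates \<open>h_fun\<close> at every \<open>\<beta> \<le> \<alpha>\<close>.\<close>

lemma sum_LLBDeu_le_h_under:
  assumes V: "finite V" "i \<in> V" "\<And>v. v \<in> V \<Longrightarrow> finite (c v)" "\<And>v. v \<in> V \<Longrightarrow> c v \<noteq> {}"
    and D: "set_mset D \<subseteq> PiE V c" and "\<alpha>ess > 0"
    and ST: "S \<subseteq> T" "T \<subseteq> V - {i}" and jS: "jS \<in> data_u D S"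
  shows "(\<Sum>j\<in>{j \<in> data_u D T. restrict j S = jS}. LLBDeu \<alpha>ess c D i T j)
    \<le> h_under \<alpha>ess c D V i S jS"
proof -
  define W where "W = V - {i}"
  define m where "m j = n_vec D i W j" for j
  define ml where "ml j = max_loglik (c i) (m j)" for j
  define \<alpha> where "\<alpha> = \<alpha>ess / real (q c S)"
  define \<beta> where "\<beta> = \<alpha>ess / real (q c T)"
  define B where "B j = Min {ml j, f_bound c D i W j + g_bound c D i W j \<alpha>, h_bar (c i) (m j) \<alpha>}" for j
  define J where "J = {j \<in> data_u D W. restrict j S = jS}"
  have K: "finite (c i)" "c i \<noteq> {}" using V by auto
  have Di: "x i \<in> c i" if "x \<in># D" for x using D V(2) that by (auto simp: PiE_iff)
  have SW: "S \<subseteq> W" "T \<subseteq> W" using ST by (auto simp: W_def)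
  have "finite T" using ST V(1) finite_subset by blast
  have ok: "finite (c v) \<and> c v \<noteq> {}" if "v \<in> T" for v using V ST that by auto
  have "q c S > 0" using ST \<open>finite T\<close> finite_subset ok by (intro q_pos) auto
  moreover have "q c S \<le> q c T" using \<open>finite T\<close> ST(1) ok by (rule q_mono)
  ultimately have \<beta>: "0 < \<beta>" "\<beta> \<le> \<alpha>"
    using \<open>\<alpha>ess > 0\<close> by (auto simp: \<alpha>_def \<beta>_def intro!: divide_left_mono)
  have hml: "h_fun (c i) (m j) \<beta> \<le> ml j" for j
    unfolding ml_def using K \<beta>(1) by (rule h_fun_le_max_loglik)
  have hB: "h_fun (c i) (m j) \<beta> \<le> B j" if "j \<in> J" for j
  proof -
    have "h_fun (c i) (m j) \<beta> \<le> f_bound c D i W j + g_bound c D i W j \<beta>"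
      unfolding m_def using K Di \<beta>(1) that by (intro h_fun_le_f_plus_g) (auto simp: J_def)
    also have "\<dots> \<le> f_bound c D i W j + g_bound c D i W j \<alpha>"
      using g_bound_mono[OF \<beta>] by simp
    finally show ?thesis
      using hml h_fun_le_h_bar[OF K \<beta>] by (simp add: B_def)
  qed
  have "finite J" by (simp add: J_def)
  have "J \<noteq> {}" using data_u_fiber_nonempty[OF SW(1) jS] by (auto simp: J_def)
  then have "(MIN j\<in>J. - ml j + B j) \<in> (\<lambda>j. - ml j + B j) ` J"
    using \<open>finite J\<close> by (intro Min_in) auto
  then obtain j0 where j0: "j0 \<in> J" "(MIN j\<in>J. - ml j + B j) = - ml j0 + B j0"
    by blast
  \<comment> \<open>\<open>b\<close> charges every full configuration its maximal log likelihood,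
    except the minimiser \<open>j0\<close>, which gets the sharper \<open>B j0\<close>.\<close>
  define b where "b = ml(j0 := B j0)"
  have step: "LLBDeu \<alpha>ess c D i T jT \<le> (\<Sum>j\<in>{j \<in> J. restrict j T = jT}. b j)"
    if jT: "jT \<in> data_u D T" "restrict jT S = jS" for jT
  proof -
    define F where "F = {j \<in> J. restrict j T = jT}"
    have "T \<inter> S = S" using ST by blast
    then have F: "F = {j \<in> data_u D W. restrict j T = jT}"
      using jT(2) by (auto simp: F_def J_def)
    have "finite F" by (simp add: F)
    have "F \<noteq> {}" using data_u_fiber_nonempty[OF SW(2) jT(1)] by (auto simp: F)
    \<comment> \<open>Take \<open>j1 = j0\<close> if \<open>j0\<close> lies in \<open>F\<close>, any
      element otherwise; then \<open>b\<close> agrees with \<open>ml\<close> on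
      \<open>F - {j1}\<close>.\<close>
    then obtain j1 where j1: "j1 \<in> F" "j0 \<notin> F - {j1}" by blast
    have "LLBDeu \<alpha>ess c D i T jT = h_fun (c i) (\<lambda>k. \<Sum>j\<in>F. m j k) \<beta>"
    proof -
      have "n_vec D i T jT = (\<lambda>k. \<Sum>j\<in>F. m j k)"
        unfolding F m_def using SW(2) by (intro ext n_vec_refine)
      moreover have "LLBDeu \<alpha>ess c D i T jT = h_fun (c i) (n_vec D i T jT) \<beta>"
        unfolding \<beta>_def using K(1) Di by (rule LLBDeu_eq_h_fun)
      ultimately show ?thesis by simp
    qed
    also have "\<dots> \<le> h_fun (c i) (m j1) \<beta> + (\<Sum>j\<in>F - {j1}. ml j)"
      unfolding ml_def using K \<beta>(1) \<open>finite F\<close> j1(1) by (rule h_fun_sum_le)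
    also have "\<dots> \<le> b j1 + (\<Sum>j\<in>F - {j1}. b j)"
      using j1 hml hB[OF j0(1)] by (intro add_mono sum_mono) (auto simp: b_def)
    also have "\<dots> = sum b F" using \<open>finite F\<close> j1(1) by (simp add: sum.remove)
    finally show ?thesis by (simp add: F_def)
  qed
  have "(\<Sum>j\<in>{j \<in> data_u D T. restrict j S = jS}. LLBDeu \<alpha>ess c D i T j)
      \<le> (\<Sum>jT\<in>{j \<in> data_u D T. restrict j S = jS}. \<Sum>j\<in>{j \<in> J. restrict j T = jT}. b j)"
    using step by (intro sum_mono) auto
  \<comment> \<open>Each element of \<open>J\<close> lies above exactly one configuration on
    \<open>T\<close>, so the bound at \<open>j0\<close> is used once in total.\<close>
  also have "\<dots> = sum b J"
    using \<open>finite J\<close> ST(1) restrict_data_u[OF SW(2)]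
    by (intro sum.group) (auto simp: J_def Int_absorb1 Int_absorb2)
  \<comment> \<open>The summand \<open>- ml j0\<close> takes \<open>j0\<close> out of the full sum
    and \<open>B j0\<close> replaces it.\<close>
  also have "\<dots> = sum ml J + (- ml j0 + B j0)"
    using \<open>finite J\<close> j0(1) by (simp add: sum.remove[of J j0] b_def)
  also have "\<dots> = h_under \<alpha>ess c D V i S jS"
    unfolding h_under_def Let_def j0(2)[symmetric]
    by (simp only: J_def ml_def[abs_def] m_def B_def \<alpha>_def W_def)
  finally show ?thesis .
qed

theorem theorem3:
  fixes n i :: nat and V S :: "nat set" and c :: "nat \<Rightarrow> 'a set"
    and D :: "(nat \<Rightarrow> 'a) multiset" and \<alpha>ess :: real
  assumes "V = {1..n}" and "i \<in> V"
    and "\<And>v. v \<in> V \<Longrightarrow> finite (c v)" and "\<And>v. v \<in> V \<Longrightarrow> c v \<noteq> {}"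
    and "set_mset D \<subseteq> PiE V c"
    and "\<alpha>ess > 0"
    and "S \<subseteq> V - {i}"
  shows "(\<forall>jS \<in> data_u D S. LLBDeu \<alpha>ess c D i S jS \<le> h_under \<alpha>ess c D V i S jS) \<and>
         ((\<exists>S'. S' \<subset> S \<and> LBDeu \<alpha>ess c D i S' \<ge> h_under_total \<alpha>ess c D V i S) \<longrightarrow>
            S \<notin> candidate_sets \<alpha>ess c D V i \<and>
            (\<forall>T. S \<subseteq> T \<and> T \<subseteq> V - {i} \<longrightarrow> T \<notin> candidate_sets \<alpha>ess c D V i))"
proof -
  have "finite V" using assms(1) by simp
  then have bound: "(\<Sum>j\<in>{j \<in> data_u D T. restrict j S = jS}. LLBDeu \<alpha>ess c D i T j)
      \<le> h_under \<alpha>ess c D V i S jS" if "S \<subseteq> T" "T \<subseteq> V - {i}" "jS \<in> data_u D S" for T jS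
    using assms(2-6) that by (intro sum_LLBDeu_le_h_under)
  have "LLBDeu \<alpha>ess c D i S jS \<le> h_under \<alpha>ess c D V i S jS" if "jS \<in> data_u D S" for jS
  proof -
    have "restrict j S = j" if "j \<in> data_u D S" for j
      using that by (auto simp: data_u_def data_proj_def)
    then have "{j \<in> data_u D S. restrict j S = jS} = {jS}"
      using that by auto
    then show ?thesis using bound[OF order_refl assms(7) that] by simp
  qed
  moreover have "T \<notin> candidate_sets \<alpha>ess c D V i"
    if T: "S \<subseteq> T" "T \<subseteq> V - {i}" and "S' \<subset> S"
      and "LBDeu \<alpha>ess c D i S' \<ge> h_under_total \<alpha>ess c D V i S" for S' T
  proof -
    \<comment> \<open>The scores on \<open>T\<close> are grouped by projection onto
      \<open>S\<close>; the resulting bound does not depend on \<open>T\<close>, and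
      \<open>S'\<close> is a proper subset of \<open>T\<close> too.\<close>
    have "LBDeu \<alpha>ess c D i T
        = (\<Sum>jS\<in>data_u D S. \<Sum>j\<in>{j \<in> data_u D T. restrict j S = jS}. LLBDeu \<alpha>ess c D i T j)"
      unfolding LBDeu_def using restrict_data_u[OF T(1)]
      by (intro sum.group[symmetric]) auto
    also have "\<dots> \<le> h_under_total \<alpha>ess c D V i S"
      unfolding h_under_total_def by (intro sum_mono bound[OF T])
    also have "\<dots> \<le> LBDeu \<alpha>ess c D i S'" by fact
    finally have "\<not> LBDeu \<alpha>ess c D i S' < LBDeu \<alpha>ess c D i T" by simp
    moreover have "S' \<subset> T" using that by blast
    ultimately show ?thesis by (auto simp: candidate_sets_def)
  qed
  ultimately show ?thesis using assms(7) by blast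
qed

end
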